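(* Let $\{x(t)\}_{t\ge 0}$ be the iterates generated by the asynchronous network Newton algorithm (defined in the context) with stepsize parameter $\varepsilon$ satisfying $$0<\varepsilon\leq 2\pi\Big(\frac{\lambda}{\Lambda}\Big)^{2}.$$ Then, for every $t\ge 1$, $$\mathbb{E}\big[F(x(t))\,\big|\,\mathcal{F}_{t-1}\big]\leq F(x(t-1))-\Big(\varepsilon\lambda-\frac{\varepsilon^{2}\Lambda^{2}}{2\lambda\pi}\Big)\|g(t-1)\|^{2},$$ and the sequence $\{F(x(t))\}$ converges to the optimal value $F^*$ almost surely.
   Context: Problem. There are $n$ agents connected by an undirected static graph $(\mathcal V,\mathcal E)$. The problem is to minimize over $x=[x_1,\dots,x_n]'\in\mathbb{R}^n$ the function $F(x)=\frac12 x'(I-W)x+\alpha\sum_{i=1}^n f_i(x_i)$, where $\alpha>0$ and $f_i:\mathbb{R}\to\mathbb{R}$. The matrix $W\in\mathbb{R}^{n\times n}$ satisfies $W'=W$, $W\mathbf 1=\mathbf 1$, $\mathrm{null}(I-W)=\mathrm{span}\{\mathbf 1\}$, $0\le W_{ij}<1$, and for $i\ne j$, $W_{ij}\neq 0$ if and only if $(i,j)\in\mathcal E$. Let $x^*$ be the minimizer of $F$ and $F^*=F(x^* )$. Norms are Euclidean (and the induced matrix norm). Standing assumptions. (1) Each $f_i$ is convex, twice continuously differentiable, and $0<m\le \nabla^2 f_i(s)\le M<\infty$ for all $s\in\mathbb{R}$. (2) Each $\nabla^2 f_i$ is $L$-Lipschitz: $|\nabla^2 f_i(s)-\nabla^2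 f_i(\bar s)|\le L|s-\bar s|$. (3) There are $0<\delta\le\Delta<1$ with $\delta\le W_{ii}\le\Delta$ for all $i$. (4) The activation probabilities $p_1,\dots,p_n$ satisfy $\sum_i p_i=1$ and $0<\pi\le p_i\le\Pi<1$ (here $\pi,\Pi$ are given scalars). $P$ is the diagonal matrix with $P_{ii}=p_i$. Notation. $g(t)=\nabla F(x(t))$; $H(t)=\nabla^2F(x(t))$; $G(t)$ is diagonal with $G_{ii}(t)=\nabla^2 f_i(x_i(t))$; $W_d$ is diagonal with $[W_d]_{ii}=W_{ii}$; $D(t)=\alpha G(t)+2(I-W_d)$; $B=I-2W_d+W$ (so $H(t)=D(t)-B$); $\hat H(t)^{-1}=D(t)^{-1/2}\big[I+D(t)^{-1/2}BD(t)^{-1/2}\big]D(t)^{-1/2}$. Constants. $\rho=\frac{2(1-\delta)}{2(1-\delta)+\alpha m}$, $\Lambda=\frac{1+\rho}{2(1-\Delta)+\alpha m}$, $\lambda=\frac{1}{2(1-\delta)+\alpha M}$. Algorithm (asynchronous network Newton). $x(0)=0$. At each iteration $t=1,2,\dots$ exactly one agent is active, agent $i$ with probability $p_i$. Let $\Phi(t)$ be the random diagonal $n\times n$ matrix with $\Phi(t)_{ii}=1$ if agent $i$ is active at time $t$ and $0$ otherwise; $\mathcal F_t$ is the $\sigma$-field capturing all activations up to and including time $t$. Conditionally on $\mathcal F_{t-1}$, $\Phi(t)=\Phi^i$ with probability $p_i$, where $\Phi^i$ is the diagonal matrix with $i$-th diagonal entry $1$ and all others $0$. The update is $x(t)=x(t-1)-\varepsilon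 P^{-1}\Phi(t)\hat H(t-1)^{-1}g(t-1)$. *)

theory Defs
  imports "HOL-Probability.Probability"
begin

text \<open>
  Agents are the elements of a finite type \<open>'n\<close>, so that \<open>real ^ 'n\<close> is the Euclidean space of
  decision vectors; \<open>1 :: real ^ 'n\<close> is the all-ones vector, whereas the identity matrix is \<open>mat 1\<close>
  (\<open>1\<close> at matrix type would be the all-ones matrix).
\<close>

definition diag :: "real ^ 'n \<Rightarrow> real ^ 'n ^ 'n" where
  "diag v = (\<chi> i j. if i = j then v $ i else 0)"

text \<open>The power \<open>A\<^sup>-\<^sup>1\<^sup>/\<^sup>2\<close>; only meant for diagonal \<open>A\<close> with positive diagonal.\<close>

definition diag_inv_sqrt :: "real ^ 'n ^ 'n \<Rightarrow> real ^ 'n ^ 'n" where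
  "diag_inv_sqrt A = diag (\<chi> i. 1 / sqrt (A $ i $ i))"

definition gradient :: "('a::real_inner \<Rightarrow> real) \<Rightarrow> 'a \<Rightarrow> 'a" where
  "gradient F x = (THE D. GDERIV F x :> D)"

definition objective :: "real ^ 'n ^ 'n \<Rightarrow> real \<Rightarrow> ('n \<Rightarrow> real \<Rightarrow> real) \<Rightarrow> real ^ 'n \<Rightarrow> real" where
  "objective W \<alpha> f x = (1/2) * (x \<bullet> ((mat 1 - W) *v x)) + \<alpha> * (\<Sum>i\<in>UNIV. f i (x $ i))"

subsection \<open>The approximate inverse Hessian\<close>

definition W_d :: "real ^ 'n ^ 'n \<Rightarrow> real ^ 'n ^ 'n" where
  "W_d W = diag (\<chi> i. W $ i $ i)"

definition G_mat :: "('n \<Rightarrow> real \<Rightarrow> real) \<Rightarrow> real ^ 'n \<Rightarrow> real ^ 'n ^ 'n" where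
  "G_mat f x = diag (\<chi> i. deriv (deriv (f i)) (x $ i))"

definition D_mat :: "real ^ 'n ^ 'n \<Rightarrow> real \<Rightarrow> ('n \<Rightarrow> real \<Rightarrow> real) \<Rightarrow> real ^ 'n \<Rightarrow> real ^ 'n ^ 'n" where
  "D_mat W \<alpha> f x = \<alpha> *\<^sub>R G_mat f x + 2 *\<^sub>R (mat 1 - W_d W)"

definition B_mat :: "real ^ 'n ^ 'n \<Rightarrow> real ^ 'n ^ 'n" where
  "B_mat W = mat 1 - 2 *\<^sub>R W_d W + W"

definition H_hat_inv ::
  "real ^ 'n ^ 'n \<Rightarrow> real \<Rightarrow> ('n \<Rightarrow> real \<Rightarrow> real) \<Rightarrow> real ^ 'n \<Rightarrow> real ^ 'n ^ 'n" where
  "H_hat_inv W \<alpha> f x =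
     (let R = diag_inv_sqrt (D_mat W \<alpha> f x)
      in R ** (mat 1 + R ** B_mat W ** R) ** R)"

definition rho_const :: "real \<Rightarrow> real \<Rightarrow> real \<Rightarrow> real" where
  "rho_const \<alpha> \<delta> m = 2 * (1 - \<delta>) / (2 * (1 - \<delta>) + \<alpha> * m)"

definition Lambda_const :: "real \<Rightarrow> real \<Rightarrow> real \<Rightarrow> real \<Rightarrow> real" where
  "Lambda_const \<alpha> \<delta> \<Delta> m = (1 + rho_const \<alpha> \<delta> m) / (2 * (1 - \<Delta>) + \<alpha> * m)"

definition lambda_const :: "real \<Rightarrow> real \<Rightarrow> real \<Rightarrow> real" where
  "lambda_const \<alpha> \<delta> M = 1 / (2 * (1 - \<delta>) + \<alpha> * M)"

subsection \<open>The algorithm\<close>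

text \<open>
  The random element \<open>act t\<close> is the unique agent active at iteration \<open>t \<ge> 1\<close>; \<open>act 0\<close> is never used.
\<close>

definition Phi :: "(nat \<Rightarrow> 'w \<Rightarrow> 'n) \<Rightarrow> nat \<Rightarrow> 'w \<Rightarrow> real ^ 'n ^ 'n" where
  "Phi act t \<omega> = diag (\<chi> i. if act t \<omega> = i then 1 else 0)"

primrec ann_iterate ::
  "real ^ 'n ^ 'n \<Rightarrow> real \<Rightarrow> ('n \<Rightarrow> real \<Rightarrow> real) \<Rightarrow> real ^ 'n \<Rightarrow> real \<Rightarrow> (nat \<Rightarrow> 'w \<Rightarrow> 'n)
     \<Rightarrow> nat \<Rightarrow> 'w \<Rightarrow> real ^ 'n" where
  "ann_iterate W \<alpha> f p \<epsilon> act 0 \<omega> = 0"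
| "ann_iterate W \<alpha> f p \<epsilon> act (Suc t) \<omega> =
     (let x = ann_iterate W \<alpha> f p \<epsilon> act t \<omega>
      in x - \<epsilon> *\<^sub>R ((matrix_inv (diag p) ** Phi act (Suc t) \<omega> ** H_hat_inv W \<alpha> f x)
                     *v gradient (objective W \<alpha> f) x))"

text \<open>The \<open>\<sigma>\<close>-field of all activations up to and including time \<open>t\<close> (trivial for \<open>t = 0\<close>).\<close>

definition act_filtration :: "'w measure \<Rightarrow> (nat \<Rightarrow> 'w \<Rightarrow> 'n) \<Rightarrow> nat \<Rightarrow> 'w measure" where
  "act_filtration \<Omega> act t =
     sigma (space \<Omega>) (\<Union>s\<in>{1..t}. range (\<lambda>A. act s -` A \<inter> space \<Omega>))"

end

(*
  A step of agent i only changes the i-th coordinate, along which F has curvature at most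
  K = 1 - delta + alpha M. Averaging the resulting quadratic upper bounds over i, together with
  lam I <= H_hat_inv and norm H_hat_inv <= Lam (the matrix B is positive semidefinite and
  diagonally dominant), gives the expected decrease with K in place of 1 / lam. As K < 1 / lam, the
  decrease c * (norm g)^2 has c > 0 even for the largest stepsize. Strong convexity bounds
  (norm g)^2 from below by the optimality gap V(t), so that E V(t) decays geometrically. Hence
  the sum of the V(t) has finite expectation and V(t) tends to 0 almost surely, without any
  martingale convergence theorem.
*)

theory Submission
  imports Defs
begin

section \<open>Coordinate formulas, diagonal matrices and weighted sums of squares\<close>

lemma vec_inner_sum: "(x :: real ^ 'n) \<bullet> y = (\<Sum>i\<in>UNIV. x $ i * y $ i)"
  by (simp add: inner_vec_def)

lemma norm_sq_sum: "(norm (x :: real ^ 'n))\<^sup>2 = (\<Sum>i\<in>UNIV. (x $ i)\<^sup>2)"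
  by (simp add: power2_norm_eq_inner inner_vec_def flip: power2_eq_square)

lemma diag_mult_vec [simp]: "(diag v *v y) $ i = v $ i * y $ i"
  by (simp add: diag_def matrix_vector_mult_def if_distrib if_distribR cong: if_cong)

lemma matrix_inv_diag:
  assumes "\<And>i. v $ i \<noteq> 0"
  shows "matrix_inv (diag v) = diag (\<chi> i. 1 / v $ i)"
proof -
  let ?D = "diag (\<chi> i. 1 / v $ i)"
  have l: "diag v ** ?D = mat 1" and r: "?D ** diag v = mat 1"
    using assms by (auto simp: matrix_eq vec_eq_iff simp flip: matrix_vector_mul_assoc)
  then have "matrix_inv (diag v) ** diag v = mat 1"
    unfolding matrix_inv_def by (rule someI2[where a = ?D, OF conjI, THEN conjunct2]) auto
  \<comment> \<open>\<open>matrix_inv\<close> is a choice among two-sided inverses; associativity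
    forces the chosen one to be \<open>?D\<close>.\<close>
  then have "matrix_inv (diag v) ** (diag v ** ?D) = ?D"
    by (metis matrix_mul_assoc matrix_mul_lid)
  then show ?thesis by (simp add: l)
qed

text \<open>The pure terms of the expanded squares collect row sums and column sums, which agree by
  symmetry. For nonnegative entries of \<open>A\<close> the left side is nonnegative, which yields
  bounds on the form of \<open>A\<close> by choosing \<open>a\<close> and \<open>b\<close>.\<close>

lemma sum_weighted_squares:
  fixes A :: "real ^ 'n ^ 'n"
  assumes sym: "\<And>i j. A $ i $ j = A $ j $ i" and r: "\<And>i. (\<Sum>j\<in>UNIV. A $ i $ j) = r i"
  shows "(\<Sum>i\<in>UNIV. \<Sum>j\<in>UNIV. A $ i $ j * (a $ i + b $ j)\<^sup>2)
    = (\<Sum>i\<in>UNIV. r i * (a $ i)\<^sup>2) + (\<Sum>i\<in>UNIV. r i * (b $ i)\<^sup>2) + 2 * (a \<bullet> (A *v b))"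
proof -
  have 1: "(\<Sum>i\<in>UNIV. \<Sum>j\<in>UNIV. A $ i $ j * (a $ i)\<^sup>2) = (\<Sum>i\<in>UNIV. r i * (a $ i)\<^sup>2)"
    by (simp add: r flip: sum_distrib_right)
  have 2: "(\<Sum>i\<in>UNIV. \<Sum>j\<in>UNIV. A $ i $ j * (b $ j)\<^sup>2) = (\<Sum>i\<in>UNIV. r i * (b $ i)\<^sup>2)"
    by (subst sum.swap, subst sym) (simp add: r flip: sum_distrib_right)
  have 3: "a \<bullet> (A *v b) = (\<Sum>i\<in>UNIV. \<Sum>j\<in>UNIV. A $ i $ j * (a $ i * b $ j))"
    by (simp add: vec_inner_sum matrix_vector_mult_def sum_distrib_left algebra_simps)
  show ?thesis unfolding 1[symmetric] 2[symmetric] 3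
    by (simp add: power2_sum algebra_simps sum_distrib_left flip: sum.distrib)
qed

text \<open>Both bounds come from Taylor's formula with Lagrange remainder: the second derivative at
  the intermediate point lies between \<open>m\<close> and \<open>M\<close>.\<close>

lemma second_order_bounds:
  fixes f :: "real \<Rightarrow> real"
  assumes d1: "\<And>s. f field_differentiable at s" and d2: "\<And>s. deriv f field_differentiable at s"
    and b: "\<And>s. m \<le> deriv (deriv f) s \<and> deriv (deriv f) s \<le> M"
  shows "f a + deriv f a * s + m / 2 * s\<^sup>2 \<le> f (a + s)"
    and "f (a + s) \<le> f a + deriv f a * s + M / 2 * s\<^sup>2"
proof -
  have "\<exists>t. f (a + s) = f a + deriv f a * s + deriv (deriv f) t / 2 * s\<^sup>2"
  proof (cases "s = 0")
    case False
    define diff where "diff = (\<lambda>k::nat. if k = 0 then f else if k = 1 then deriv f else deriv (deriv f))"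
    \<comment> \<open>The interval is centred at \<open>a\<close> with radius
      \<open>\<bar>s\<bar>\<close>, so it contains \<open>a + s\<close> for either sign of
      \<open>s\<close>.\<close>
    have "\<forall>k t. k < 2 \<and> a - \<bar>s\<bar> \<le> t \<and> t \<le> a + \<bar>s\<bar> \<longrightarrow> DERIV (diff k) t :> diff (Suc k) t"
      using d1 d2 by (auto simp: diff_def less_2_cases_iff DERIV_deriv_iff_field_differentiable)
    from Taylor[of 2 diff f "a - \<bar>s\<bar>" "a + \<bar>s\<bar>" a "a + s", OF _ _ this]
      abs_ge_self[of s] abs_ge_minus_self[of s] False
    obtain t where "f (a + s) = (\<Sum>k<2. (diff k a / fact k) * (a + s - a) ^ k)
        + (diff 2 t / fact 2) * (a + s - a)\<^sup>2"
      by (auto simp: diff_def[THEN fun_cong, of 0])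
    then show ?thesis by (intro exI[of _ t]) (simp add: diff_def numeral_2_eq_2)
  qed auto
  then obtain t where "f (a + s) = f a + deriv f a * s + deriv (deriv f) t / 2 * s\<^sup>2" ..
  then show "f a + deriv f a * s + m / 2 * s\<^sup>2 \<le> f (a + s)"
      "f (a + s) \<le> f a + deriv f a * s + M / 2 * s\<^sup>2"
    using b[of t] by (auto intro!: mult_right_mono)
qed

section \<open>Deterministic setting: weight matrix and local costs\<close>

locale penalized_consensus =
  fixes W :: "real ^ 'n ^ 'n" and \<alpha> m M \<delta> \<Delta> :: real and f :: "'n \<Rightarrow> real \<Rightarrow> real"
  assumes alpha: "\<alpha> > 0"
    and W_symmetric: "transpose W = W"
    and W_ones: "W *v 1 = 1"
    and W_nonneg: "\<And>i j. 0 \<le> W $ i $ j"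
    and f_diff: "\<And>i s. f i field_differentiable at s"
    and f_diff2: "\<And>i s. deriv (f i) field_differentiable at s"
    and m_pos: "0 < m"
    and f_bounds: "\<And>i s. m \<le> deriv (deriv (f i)) s \<and> deriv (deriv (f i)) s \<le> M"
    and delta: "\<delta> \<le> \<Delta>" "\<Delta> < 1"
    and W_diag: "\<And>i. \<delta> \<le> W $ i $ i \<and> W $ i $ i \<le> \<Delta>"
begin

abbreviation F where "F \<equiv> objective W \<alpha> f"

abbreviation D where "D \<equiv> \<lambda>x i. \<alpha> * deriv (deriv (f i)) (x $ i) + 2 * (1 - W $ i $ i)"

abbreviation lam where "lam \<equiv> lambda_const \<alpha> \<delta> M"

abbreviation Lam where "Lam \<equiv> Lambda_const \<alpha> \<delta> \<Delta> m"

abbreviation rho where "rho \<equiv> rho_const \<alpha> \<delta> m"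

lemma m_le_M: "m \<le> M"
  using f_bounds order_trans by blast

lemma W_swap: "W $ i $ j = W $ j $ i"
  using W_symmetric by (metis transpose_def vec_lambda_beta)

lemma W_row_sum: "(\<Sum>j\<in>UNIV. W $ i $ j) = 1"
  using W_ones by (simp add: vec_eq_iff matrix_vector_mult_def)

text \<open>As the rows of \<open>W\<close> sum to one, the form is half the sum of
  \<open>W_ij (h_i - h_j)^2\<close>.\<close>

lemma laplacian_nonneg: "0 \<le> h \<bullet> ((mat 1 - W) *v h)"
proof -
  have "0 \<le> (\<Sum>i\<in>UNIV. \<Sum>j\<in>UNIV. W $ i $ j * (h $ i + (- h) $ j)\<^sup>2)"
    by (intro sum_nonneg mult_nonneg_nonneg W_nonneg) auto
  also have "\<dots> = 2 * (h \<bullet> h) - 2 * (h \<bullet> (W *v h))"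
    by (subst sum_weighted_squares[OF W_swap W_row_sum])
      (simp add: vec_inner_sum power2_eq_square linear_neg[OF matrix_vector_mul_linear]
        sum_negf)
  finally show ?thesis by (simp add: matrix_vector_mult_diff_rdistrib inner_diff_right)
qed

section \<open>The matrix \<open>B\<close>: row sums, semidefiniteness and a bilinear bound\<close>

lemma B_entry: "B_mat W $ i $ j = (if i = j then 1 - W $ i $ i else W $ i $ j)"
  by (simp add: B_mat_def W_d_def diag_def mat_def)

lemma B_nonneg: "0 \<le> B_mat W $ i $ j"
  using W_diag[of i] delta W_nonneg[of i j] by (auto simp: B_entry)

lemma B_swap: "B_mat W $ i $ j = B_mat W $ j $ i"
  by (auto simp: B_entry W_swap)

lemma offdiag_row_sum: "(\<Sum>j\<in>UNIV. if i = j then 0 else W $ i $ j) = 1 - W $ i $ i"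
proof -
  have "(\<Sum>j\<in>UNIV. if i = j then 0 else W $ i $ j)
      = (\<Sum>j\<in>UNIV. W $ i $ j - (if i = j then W $ i $ j else 0))"
    by (intro sum.cong) auto
  then show ?thesis by (simp add: sum_subtractf W_row_sum)
qed

lemma B_row_sum: "(\<Sum>j\<in>UNIV. B_mat W $ i $ j) = 2 * (1 - W $ i $ i)"
proof -
  have "(\<Sum>j\<in>UNIV. B_mat W $ i $ j)
      = (\<Sum>j\<in>UNIV. (if i = j then 0 else W $ i $ j) + (if i = j then 1 - W $ i $ i else 0))"
    by (intro sum.cong) (auto simp: B_entry)
  then show ?thesis by (simp add: sum.distrib offdiag_row_sum)
qed

text \<open>Each diagonal entry of \<open>B\<close> equals the sum of the other entries in its row,
  so the form is half the sum over \<open>i \<noteq> j\<close> of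
  \<open>W_ij (y_i + y_j)^2\<close>.\<close>

lemma B_psd: "0 \<le> y \<bullet> (B_mat W *v y)"
proof -
  let ?O = "(\<chi> i j. if i = j then 0 else W $ i $ j) :: real ^ 'n ^ 'n"
  have B: "B_mat W = ?O + diag (\<chi> i. 1 - W $ i $ i)"
    by (simp add: vec_eq_iff B_entry diag_def)
  have "0 \<le> (\<Sum>i\<in>UNIV. \<Sum>j\<in>UNIV. ?O $ i $ j * (y $ i + y $ j)\<^sup>2)"
    by (intro sum_nonneg mult_nonneg_nonneg) (auto simp: W_nonneg)
  also have "\<dots> = 2 * (\<Sum>i\<in>UNIV. (1 - W $ i $ i) * (y $ i)\<^sup>2) + 2 * (y \<bullet> (?O *v y))"
    by (subst sum_weighted_squares[where r = "\<lambda>i. 1 - W $ i $ i"])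
      (auto simp: offdiag_row_sum W_swap)
  also have "\<dots> = 2 * (y \<bullet> (B_mat W *v y))"
    by (simp add: B matrix_vector_mult_add_rdistrib inner_add_right vec_inner_sum[of y "diag _ *v y"]
        power2_eq_square mult_ac)
  finally show ?thesis by simp
qed

text \<open>Expanding the nonnegative sum of \<open>B_ij (z_j - y_i)^2\<close> gives this bound,
  which replaces spectral theory in the norm estimate for \<open>S\<close>.\<close>

lemma B_bilinear:
  "2 * (y \<bullet> (B_mat W *v z))
     \<le> (\<Sum>i\<in>UNIV. 2 * (1 - W $ i $ i) * (y $ i)\<^sup>2) + (\<Sum>i\<in>UNIV. 2 * (1 - W $ i $ i) * (z $ i)\<^sup>2)"
proof -
  have "0 \<le> (\<Sum>i\<in>UNIV. \<Sum>j\<in>UNIV. B_mat W $ i $ j * ((- y) $ i + z $ j)\<^sup>2)"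
    by (intro sum_nonneg mult_nonneg_nonneg) (auto simp: B_nonneg)
  also have "\<dots> = (\<Sum>i\<in>UNIV. 2 * (1 - W $ i $ i) * (y $ i)\<^sup>2)
      + (\<Sum>i\<in>UNIV. 2 * (1 - W $ i $ i) * (z $ i)\<^sup>2) - 2 * (y \<bullet> (B_mat W *v z))"
    by (subst sum_weighted_squares[OF B_swap B_row_sum]) simp
  finally show ?thesis by simp
qed

section \<open>Bounds on the diagonal entries of \<open>D\<close>\<close>

lemma D_lower: "2 * (1 - \<Delta>) + \<alpha> * m \<le> D x i"
proof -
  have "\<alpha> * m \<le> \<alpha> * deriv (deriv (f i)) (x $ i)"
    using f_bounds alpha by (intro mult_left_mono) auto
  then show ?thesis using W_diag[of i] by simp
qed

lemma D_upper: "D x i \<le> 2 * (1 - \<delta>) + \<alpha> * M"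
proof -
  have "\<alpha> * deriv (deriv (f i)) (x $ i) \<le> \<alpha> * M"
    using f_bounds alpha by (intro mult_left_mono) auto
  then show ?thesis using W_diag[of i] by simp
qed

lemma D_lower_pos: "0 < 2 * (1 - \<Delta>) + \<alpha> * m"
  using delta alpha m_pos by (simp add: add_pos_pos)

lemma D_pos: "0 < D x i"
  using D_lower D_lower_pos less_le_trans by blast

lemma D_upper_pos: "0 < 2 * (1 - \<delta>) + \<alpha> * M"
  using D_pos D_upper less_le_trans by blast

lemma rho_pos: "0 < rho"
  unfolding rho_const_def using delta alpha m_pos by (intro divide_pos_pos add_pos_pos) auto

text \<open>The quotient \<open>b / (b + a)\<close> increases in \<open>b\<close> and decreases in
  \<open>a\<close>; at the extremes \<open>b = 2 (1 - \<delta>)\<close> and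
  \<open>a = \<alpha> m\<close> it equals \<open>rho\<close>.\<close>

lemma diag_B_le: "2 * (1 - W $ i $ i) \<le> rho * D x i"
proof -
  let ?b = "2 * (1 - W $ i $ i)" and ?c = "2 * (1 - \<delta>)" and ?a = "\<alpha> * m"
  have a: "0 < ?a" "?a \<le> \<alpha> * deriv (deriv (f i)) (x $ i)" and b: "0 \<le> ?b" "?b \<le> ?c"
    using alpha m_pos f_bounds[of i] W_diag[of i] delta by auto
  have "?b * (?c + ?a) \<le> ?c * (?b + ?a)"
    using mult_right_mono[OF b(2), of ?a] a by (simp add: algebra_simps)
  also have "\<dots> \<le> ?c * D x i"
    using a b by (intro mult_left_mono) auto
  finally show ?thesis
    using a b unfolding rho_const_def by (simp add: field_simps)
qed

section \<open>The approximate inverse Hessian: norm bound and coercivity\<close>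

lemma D_mat_entry: "D_mat W \<alpha> f x $ i $ i = D x i"
  by (simp add: D_mat_def G_mat_def W_d_def diag_def mat_def)

abbreviation R where "R \<equiv> \<lambda>x. diag_inv_sqrt (D_mat W \<alpha> f x)"

lemma R_mult_vec: "(R x *v v) $ i = v $ i / sqrt (D x i)"
  by (simp add: diag_inv_sqrt_def D_mat_entry)

lemma R_self_adjoint: "u \<bullet> (R x *v v) = (R x *v u) \<bullet> v"
  by (simp add: vec_inner_sum R_mult_vec)

lemma R_norm_sq: "(norm (R x *v v))\<^sup>2 = (\<Sum>i\<in>UNIV. (v $ i)\<^sup>2 / D x i)"
  using D_pos[of _ x] by (simp add: norm_sq_sum R_mult_vec power_divide less_imp_le)

text \<open>The action of \<open>D^(-1/2) B D^(-1/2)\<close>; the approximate inverse Hessian is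
  then \<open>R (I + S) R\<close>.\<close>

abbreviation S where "S \<equiv> \<lambda>x v. R x *v (B_mat W *v (R x *v v))"

lemma H_hat_inv_mult_vec: "H_hat_inv W \<alpha> f x *v v = R x *v (R x *v v + S x (R x *v v))"
  by (simp add: H_hat_inv_def Let_def matrix_vector_mult_add_rdistrib
      flip: matrix_vector_mul_assoc)

text \<open>A duality argument: \<open>B_bilinear\<close> is applied to \<open>R u\<close> and
  \<open>R v\<close>. By \<open>diag_B_le\<close> its weights are at most \<open>rho D\<close>, and
  the factor \<open>D\<close> cancels against the two factors \<open>R\<close>.\<close>

lemma S_norm_le: "norm (S x v) \<le> rho * norm v"
proof -
  have weight: "(\<Sum>i\<in>UNIV. 2 * (1 - W $ i $ i) * ((R x *v w) $ i)\<^sup>2) \<le> rho * (norm w)\<^sup>2" for w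
  proof -
    have "2 * (1 - W $ i $ i) * ((R x *v w) $ i)\<^sup>2 \<le> rho * (w $ i)\<^sup>2" for i
    proof -
      have "2 * (1 - W $ i $ i) * ((R x *v w) $ i)\<^sup>2 \<le> rho * D x i * ((R x *v w) $ i)\<^sup>2"
        by (intro mult_right_mono diag_B_le) auto
      also have "\<dots> = rho * (w $ i)\<^sup>2"
        using D_pos[of i x] by (simp add: R_mult_vec power_divide)
      finally show ?thesis .
    qed
    then show ?thesis by (simp add: norm_sq_sum sum_distrib_left sum_mono)
  qed
  \<comment> \<open>The scaling \<open>1 / rho\<close> is chosen so that the next inequality reads
    \<open>2 |s|^2 / rho \<le> |s|^2 / rho + rho |v|^2\<close>.\<close>
  let ?s = "S x v" and ?u = "(1 / rho) *\<^sub>R S x v"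
  have "2 * (?u \<bullet> ?s) \<le> rho * (norm ?u)\<^sup>2 + rho * (norm v)\<^sup>2"
    using B_bilinear[of "R x *v ?u" "R x *v v"] weight[of ?u] weight[of v]
    by (simp only: R_self_adjoint)
  then have "(norm ?s)\<^sup>2 \<le> (rho * norm v)\<^sup>2"
    using rho_pos by (simp add: power_mult_distrib dot_square_norm field_simps power2_eq_square)
  then show ?thesis
    using rho_pos by (simp add: power2_le_iff_abs_le)
qed

lemma R_norm_le: "norm (R x *v v) \<le> norm v / sqrt (2 * (1 - \<Delta>) + \<alpha> * m)"
proof -
  have "(norm (R x *v v))\<^sup>2 \<le> (\<Sum>i\<in>UNIV. (v $ i)\<^sup>2 / (2 * (1 - \<Delta>) + \<alpha> * m))"
    unfolding R_norm_sq using D_lower[of _ x] D_lower_pos D_pos[of _ x]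
    by (intro sum_mono divide_left_mono mult_pos_pos) auto
  also have "\<dots> = (norm v / sqrt (2 * (1 - \<Delta>) + \<alpha> * m))\<^sup>2"
    using D_lower_pos by (simp add: norm_sq_sum power_divide sum_divide_distrib)
  finally show ?thesis using D_lower_pos by (simp add: power2_le_iff_abs_le)
qed

text \<open>Each factor \<open>R\<close> contributes \<open>1 / ?q\<close> and the middle factor
  contributes \<open>1 + rho\<close>; the product is \<open>Lam\<close>.\<close>

lemma H_hat_inv_norm_le: "norm (H_hat_inv W \<alpha> f x *v v) \<le> Lam * norm v"
proof -
  let ?q = "sqrt (2 * (1 - \<Delta>) + \<alpha> * m)"
  have q: "?q > 0" using D_lower_pos by simp
  have "norm (R x *v v + S x (R x *v v)) \<le> (1 + rho) * norm (R x *v v)"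
    using norm_triangle_ineq[of "R x *v v" "S x (R x *v v)"] S_norm_le[of x "R x *v v"]
    by (simp add: distrib_right)
  also have "\<dots> \<le> (1 + rho) * (norm v / ?q)"
    using rho_pos by (intro mult_left_mono R_norm_le) auto
  finally have "norm (R x *v v + S x (R x *v v)) / ?q \<le> (1 + rho) * (norm v / ?q) / ?q"
    using q by (intro divide_right_mono) auto
  also have "\<dots> = Lam * norm v"
    using D_lower_pos by (simp add: Lambda_const_def)
  finally show ?thesis
    unfolding H_hat_inv_mult_vec using R_norm_le[of x "R x *v v + S x (R x *v v)"] by linarith
qed

text \<open>With \<open>w = R v\<close> the form is \<open>|w|^2 + w . S w\<close>. The second term
  is nonnegative by \<open>B_psd\<close>, and the first is controlled because the entries of
  \<open>D\<close> are at most \<open>1 / lam\<close>.\<close>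

lemma H_hat_inv_coercive: "lam * (norm v)\<^sup>2 \<le> v \<bullet> (H_hat_inv W \<alpha> f x *v v)"
proof -
  have "lam * (norm v)\<^sup>2 = (\<Sum>i\<in>UNIV. (v $ i)\<^sup>2 / (2 * (1 - \<delta>) + \<alpha> * M))"
    by (simp add: lambda_const_def norm_sq_sum sum_divide_distrib)
  also have "\<dots> \<le> (norm (R x *v v))\<^sup>2"
    unfolding R_norm_sq using D_upper[of _ x] D_pos[of _ x] D_upper_pos
    by (intro sum_mono divide_left_mono mult_pos_pos) auto
  also have "\<dots> \<le> (norm (R x *v v))\<^sup>2 + (R x *v v) \<bullet> S x (R x *v v)"
    using B_psd by (simp add: R_self_adjoint)
  also have "\<dots> = v \<bullet> (H_hat_inv W \<alpha> f x *v v)"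
    by (simp add: H_hat_inv_mult_vec R_self_adjoint inner_add_right dot_square_norm)
  finally show ?thesis .
qed

section \<open>Gradient, curvature bounds and minimizer of the objective\<close>

abbreviation grad where "grad \<equiv> \<lambda>x. (mat 1 - W) *v x + \<alpha> *\<^sub>R (\<chi> i. deriv (f i) (x $ i))"

lemma laplacian_self_adjoint: "u \<bullet> ((mat 1 - W) *v v) = v \<bullet> ((mat 1 - W) *v u)"
proof -
  have "transpose (mat 1 - W) = mat 1 - W"
    by (simp add: vec_eq_iff transpose_def mat_def W_swap)
  then show ?thesis by (metis dot_lmul_matrix inner_commute vector_transpose_matrix)
qed

text \<open>The product rule gives two terms in \<open>I - W\<close>, equal by symmetry, which
  absorb the factor one half.\<close>

lemma F_GDERIV: "GDERIV F x :> grad x"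
proof -
  have f: "((\<lambda>y. f i (y $ i)) has_derivative (\<lambda>h. deriv (f i) (x $ i) * h $ i)) (at x)" for i
  proof -
    have "(f i has_derivative (\<lambda>h. deriv (f i) (x $ i) * h)) (at (x $ i))"
      using f_diff[of i] by (simp add: field_differentiable_derivI has_field_derivative_imp_has_derivative)
    from has_derivative_compose[OF bounded_linear_imp_has_derivative[OF bounded_linear_vec_nth] this]
    show ?thesis .
  qed
  have L: "((\<lambda>y. (mat 1 - W) *v y) has_derivative (\<lambda>h. (mat 1 - W) *v h)) (at x)"
    by (intro bounded_linear_imp_has_derivative matrix_vector_mul_bounded_linear)
  have "(F has_derivative (\<lambda>h. 1/2 * (x \<bullet> ((mat 1 - W) *v h) + h \<bullet> ((mat 1 - W) *v x))
       + \<alpha> * (\<Sum>i\<in>UNIV. deriv (f i) (x $ i) * h $ i))) (at x)"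
    unfolding objective_def[abs_def]
    by (intro has_derivative_add has_derivative_mult_right has_derivative_inner has_derivative_ident
        L has_derivative_sum f)
  moreover have "1/2 * (x \<bullet> ((mat 1 - W) *v h) + h \<bullet> ((mat 1 - W) *v x))
       + \<alpha> * (\<Sum>i\<in>UNIV. deriv (f i) (x $ i) * h $ i) = h \<bullet> grad x" for h
    by (simp add: laplacian_self_adjoint[of x h] inner_add_right vec_inner_sum[of h "\<chi> i. _ i"] mult_ac)
  ultimately show ?thesis by (simp add: gderiv_def)
qed

text \<open>\<open>gradient\<close> is a definite description, so uniqueness of the derivative is
  required besides \<open>F_GDERIV\<close>.\<close>

lemma gradient_F: "gradient F x = grad x"
  unfolding gradient_def
proof (rule the_equality)
  show "GDERIV F x :> grad x" by (rule F_GDERIV)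
next
  fix d assume "GDERIV F x :> d"
  then have "(\<lambda>h. h \<bullet> d) = (\<lambda>h. h \<bullet> grad x)"
    using F_GDERIV has_derivative_unique unfolding gderiv_def by blast
  then show "d = grad x" by (metis vector_eq_ldot)
qed

text \<open>The quadratic part expands exactly. Only the separable part remains to be estimated:
  from below for strong convexity, from above for a coordinate step.\<close>

lemma F_add: "F (x + h) = F x + h \<bullet> ((mat 1 - W) *v x) + h \<bullet> ((mat 1 - W) *v h) / 2
    + \<alpha> * (\<Sum>i\<in>UNIV. f i (x $ i + h $ i) - f i (x $ i))"
proof -
  have "(x + h) \<bullet> ((mat 1 - W) *v (x + h)) = x \<bullet> ((mat 1 - W) *v x)
      + 2 * (h \<bullet> ((mat 1 - W) *v x)) + h \<bullet> ((mat 1 - W) *v h)"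
    by (simp only: matrix_vector_right_distrib inner_add_left inner_add_right
        laplacian_self_adjoint[of x h])
  then show ?thesis
    by (simp add: objective_def sum_subtractf right_diff_distrib)
qed

text \<open>The modulus \<open>\<alpha> m\<close> comes from the local costs alone; the form of
  \<open>I - W\<close> is dropped as nonnegative.\<close>

lemma F_strongly_convex: "F x + h \<bullet> gradient F x + \<alpha> * m / 2 * (norm h)\<^sup>2 \<le> F (x + h)"
proof -
  have "deriv (f i) (x $ i) * h $ i + m / 2 * (h $ i)\<^sup>2 \<le> f i (x $ i + h $ i) - f i (x $ i)" for i
    using second_order_bounds(1)[OF f_diff f_diff2 f_bounds, of i "x $ i" "h $ i"] by simp
  then have "\<alpha> * (\<Sum>i\<in>UNIV. deriv (f i) (x $ i) * h $ i + m / 2 * (h $ i)\<^sup>2)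
      \<le> \<alpha> * (\<Sum>i\<in>UNIV. f i (x $ i + h $ i) - f i (x $ i))"
    using alpha by (intro mult_left_mono sum_mono) auto
  also have "\<alpha> * (\<Sum>i\<in>UNIV. deriv (f i) (x $ i) * h $ i + m / 2 * (h $ i)\<^sup>2)
      = h \<bullet> (\<alpha> *\<^sub>R (\<chi> i. deriv (f i) (x $ i))) + \<alpha> * m / 2 * (norm h)\<^sup>2"
    by (simp add: vec_inner_sum norm_sq_sum sum.distrib sum_distrib_left algebra_simps)
  finally show ?thesis
    unfolding F_add gradient_F using laplacian_nonneg[of h] by (simp add: inner_add_right)
qed

text \<open>Along axis \<open>i\<close> the form of \<open>I - W\<close> is
  \<open>(1 - W_ii) s^2\<close> and only \<open>f i\<close> changes, which keeps the curvature
  constant below \<open>1 / lam\<close>.\<close>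

lemma F_coordinate_step:
  "F (x + axis i s) \<le> F x + s * gradient F x $ i + (1 - \<delta> + \<alpha> * M) / 2 * s\<^sup>2"
proof -
  have L: "axis i s \<bullet> ((mat 1 - W) *v axis i s) = (1 - W $ i $ i) * s\<^sup>2"
  proof -
    have "((mat 1 - W) *v axis i s) $ i = (\<Sum>j\<in>UNIV. if j = i then (1 - W $ i $ i) * s else 0)"
      unfolding matrix_vector_mult_def vec_lambda_beta
      by (intro sum.cong) (auto simp: axis_def mat_def)
    then show ?thesis by (simp add: inner_axis' power2_eq_square)
  qed
  have "(\<Sum>j\<in>UNIV. f j (x $ j + axis i s $ j) - f j (x $ j))
      = (\<Sum>j\<in>UNIV. if j = i then f i (x $ i + s) - f i (x $ i) else 0)"
    by (intro sum.cong) (auto simp: axis_def)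
  also have "\<dots> = f i (x $ i + s) - f i (x $ i)" by simp
  finally have S: "(\<Sum>j\<in>UNIV. f j (x $ j + axis i s $ j) - f j (x $ j))
      = f i (x $ i + s) - f i (x $ i)" .
  have "\<alpha> * (f i (x $ i + s) - f i (x $ i)) \<le> \<alpha> * (deriv (f i) (x $ i) * s + M / 2 * s\<^sup>2)"
    using second_order_bounds(2)[OF f_diff f_diff2 f_bounds, of i "x $ i" s] alpha
    by (intro mult_left_mono) auto
  moreover have "(1 - W $ i $ i) * s\<^sup>2 \<le> (1 - \<delta>) * s\<^sup>2"
    using W_diag[of i] by (intro mult_right_mono) auto
  ultimately show ?thesis
    unfolding F_add L S by (simp add: gradient_F inner_axis' algebra_simps add_divide_distrib diff_divide_distrib)
qed

lemma continuous_F: "continuous_on UNIV F"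
  using F_GDERIV unfolding gderiv_def
  by (meson continuous_at_imp_continuous_on has_derivative_continuous)

text \<open>\<open>arg_min\<close> is a choice, so a minimizer must be shown to exist. Strong
  convexity at the origin gives \<open>F 0 \<le> F y\<close> outside a ball, hence a minimum over
  the compact ball is global.\<close>

lemma F_arg_min_le: "F (arg_min F (\<lambda>_. True)) \<le> F y"
proof -
  \<comment> \<open>At this radius the quadratic growth from strong convexity balances the largest
    possible linear loss.\<close>
  let ?r = "2 * norm (gradient F 0) / (\<alpha> * m)"
  have r: "0 \<le> ?r" using alpha m_pos by simp
  obtain z where z: "z \<in> cball 0 ?r" "\<And>y. y \<in> cball 0 ?r \<Longrightarrow> F z \<le> F y"
    using continuous_attains_inf[of "cball 0 ?r" F] continuous_on_subset[OF continuous_F] r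
    by (metis compact_cball cball_eq_empty not_less subset_UNIV)
  have "F z \<le> F y" for y
  proof (cases "y \<in> cball 0 ?r")
    case False
    then have "2 * norm (gradient F 0) < \<alpha> * m * norm y"
      using alpha m_pos by (simp add: field_simps)
    then have "norm (gradient F 0) * norm y \<le> \<alpha> * m / 2 * norm y * norm y"
      by (intro mult_right_mono) auto
    moreover have "- (norm (gradient F 0) * norm y) \<le> y \<bullet> gradient F 0"
      using Cauchy_Schwarz_ineq2[of y "gradient F 0"] by (simp add: mult.commute abs_le_iff)
    ultimately have "F 0 \<le> F y"
      using F_strongly_convex[of 0 y] by (simp add: power2_eq_square algebra_simps)
    then show ?thesis using z(2)[of 0] r by simp
  qed (use z in blast)
  then show ?thesis by (subst arg_min_equality[of _ z]) auto
qed

text \<open>Minimizing the strong convexity bound over \<open>h\<close> gives the Polyak-Lojasiewicz inequality.\<close>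

lemma F_gap_le: "F x - F y \<le> (norm (gradient F x))\<^sup>2 / (2 * (\<alpha> * m))"
proof -
  let ?g = "gradient F x" and ?h = "y - x" and ?\<mu> = "\<alpha> * m"
  have mu: "?\<mu> > 0" using alpha m_pos by simp
  \<comment> \<open>Completing the square in \<open>h\<close>: the square vanishes at the minimizing
    \<open>h = - g / \<mu>\<close>.\<close>
  have "0 \<le> (norm (?g + ?\<mu> *\<^sub>R ?h))\<^sup>2 / (2 * ?\<mu>)" using mu by simp
  also have "\<dots> = (norm ?g)\<^sup>2 / (2 * ?\<mu>) + ?h \<bullet> ?g + ?\<mu> / 2 * (norm ?h)\<^sup>2"
  proof -
    \<comment> \<open>Here \<open>a\<close>, \<open>b\<close>, \<open>c\<close> stand for
      \<open>|g|^2\<close>, \<open>h . g\<close> and \<open>|h|^2\<close>.\<close>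
    have "(a + \<mu> * b + \<mu> * (b + \<mu> * c)) / (2 * \<mu>) = a / (2 * \<mu>) + b + \<mu> / 2 * c"
      if "\<mu> > 0" for a b c \<mu> :: real
      using that by (simp add: field_simps)
    from this[OF mu] show ?thesis
      unfolding power2_norm_eq_inner inner_add_left inner_add_right inner_scaleR_left
        inner_scaleR_right inner_commute[of ?g ?h]
      by (simp only: distrib_left)
  qed
  finally show ?thesis
    using F_strongly_convex[of x ?h] by simp
qed

section \<open>Expected decrease in one update\<close>

lemma lam_pos: "0 < lam"
  using D_upper_pos by (simp add: lambda_const_def)

lemma Lam_pos: "0 < Lam"
  using D_lower_pos rho_pos by (simp add: Lambda_const_def)

abbreviation K where "K \<equiv> 1 - \<delta> + \<alpha> * M"

lemma K_pos: "0 < K"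
  using delta alpha m_pos m_le_M by (intro add_pos_pos) auto

text \<open>\<open>1 / lam\<close> exceeds \<open>K\<close> by \<open>1 - \<delta>\<close>, the
  slack that the largest stepsize relies on.\<close>

lemma K_lam_less_1: "K * lam < 1"
  using delta D_upper_pos by (simp add: lambda_const_def)

text \<open>\<open>P^(-1) Phi\<close> keeps one coordinate of the direction, so an update is a move
  along one axis. Taking the active agent as an argument turns conditional expectations into finite
  sums.\<close>

definition step :: "real ^ 'n \<Rightarrow> real \<Rightarrow> real ^ 'n \<Rightarrow> 'n \<Rightarrow> real ^ 'n" where
  "step p \<epsilon> x i = x + axis i (- \<epsilon> * ((H_hat_inv W \<alpha> f x *v gradient F x) $ i / p $ i))"

lemma ann_iterate_Suc:
  assumes "\<And>i. p $ i \<noteq> 0"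
  shows "ann_iterate W \<alpha> f p \<epsilon> act (Suc t) \<omega>
    = step p \<epsilon> (ann_iterate W \<alpha> f p \<epsilon> act t \<omega>) (act (Suc t) \<omega>)"
  by (simp add: Let_def step_def matrix_inv_diag[OF assms] Phi_def vec_eq_iff axis_def
      flip: matrix_vector_mul_assoc)

text \<open>The weight \<open>p_i\<close> cancels \<open>1 / p_i\<close> in the linear term, which
  sums to \<open>g . d\<close>. The quadratic term retains one \<open>1 / p_i\<close>, at most
  \<open>1 / p_min\<close>.\<close>

lemma expected_step_le:
  assumes "0 \<le> \<epsilon>" "0 < p_min" and p: "\<And>i. p_min \<le> p $ i" "(\<Sum>i\<in>UNIV. p $ i) = 1"
  shows "(\<Sum>i\<in>UNIV. p $ i * F (step p \<epsilon> x i))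
    \<le> F x - (\<epsilon> * lam - \<epsilon>\<^sup>2 * Lam\<^sup>2 * K / (2 * p_min)) * (norm (gradient F x))\<^sup>2"
proof -
  define g where "g = gradient F x"
  define d where "d = H_hat_inv W \<alpha> f x *v g"
  have pos: "0 < p $ i" for i using assms less_le_trans by blast
  have "p $ i * F (step p \<epsilon> x i)
      \<le> p $ i * F x - \<epsilon> * (g $ i * d $ i) + \<epsilon>\<^sup>2 * K / (2 * p_min) * (d $ i)\<^sup>2" for i
  proof -
    have "p $ i * F (step p \<epsilon> x i)
        \<le> p $ i * (F x + (- \<epsilon> * (d $ i / p $ i)) * g $ i + K / 2 * (- \<epsilon> * (d $ i / p $ i))\<^sup>2)"
      using pos[of i] unfolding step_def d_def g_def
      by (intro mult_left_mono F_coordinate_step) auto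
    also have "\<dots> = p $ i * F x - \<epsilon> * (g $ i * d $ i) + \<epsilon>\<^sup>2 * K / 2 * (d $ i)\<^sup>2 / p $ i"
      using pos[of i] by (simp add: field_simps power2_eq_square)
    also have "\<epsilon>\<^sup>2 * K / 2 * (d $ i)\<^sup>2 / p $ i \<le> \<epsilon>\<^sup>2 * K / 2 * (d $ i)\<^sup>2 / p_min"
      using K_pos assms(2) p(1)[of i] pos[of i]
      by (intro divide_left_mono mult_nonneg_nonneg mult_pos_pos) auto
    finally show ?thesis by simp
  qed
  then have "(\<Sum>i\<in>UNIV. p $ i * F (step p \<epsilon> x i))
      \<le> (\<Sum>i\<in>UNIV. p $ i * F x - \<epsilon> * (g $ i * d $ i) + \<epsilon>\<^sup>2 * K / (2 * p_min) * (d $ i)\<^sup>2)"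
    by (rule sum_mono)
  also have "\<dots> = F x - \<epsilon> * (g \<bullet> d) + \<epsilon>\<^sup>2 * K / (2 * p_min) * (norm d)\<^sup>2"
    by (simp add: sum.distrib sum_subtractf vec_inner_sum norm_sq_sum p(2)
        flip: sum_distrib_left sum_distrib_right sum_divide_distrib)
  finally have *: "(\<Sum>i\<in>UNIV. p $ i * F (step p \<epsilon> x i))
      \<le> F x - \<epsilon> * (g \<bullet> d) + \<epsilon>\<^sup>2 * K / (2 * p_min) * (norm d)\<^sup>2" .
  have "\<epsilon> * (lam * (norm g)\<^sup>2) \<le> \<epsilon> * (g \<bullet> d)"
    unfolding d_def by (intro mult_left_mono H_hat_inv_coercive assms(1))
  moreover have "(norm d)\<^sup>2 \<le> Lam\<^sup>2 * (norm g)\<^sup>2"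
    unfolding d_def power_mult_distrib[symmetric] by (intro power_mono H_hat_inv_norm_le) auto
  then have "\<epsilon>\<^sup>2 * K / (2 * p_min) * (norm d)\<^sup>2 \<le> \<epsilon>\<^sup>2 * K / (2 * p_min) * (Lam\<^sup>2 * (norm g)\<^sup>2)"
    using K_pos assms(2) by (intro mult_left_mono) auto
  ultimately show ?thesis using * by (simp add: g_def algebra_simps)
qed

end

section \<open>Conditional expectations over finitely many activations\<close>

lemma real_cond_exp_finite_kernel:
  fixes a :: "'w \<Rightarrow> 'n :: finite" and h :: "'b \<Rightarrow> 'n \<Rightarrow> real"
  assumes "prob_space \<Omega>" and sub: "subalgebra \<Omega> N" and X: "simple_function N X"
    and a: "a \<in> measurable \<Omega> (count_space UNIV)"
    and p: "\<And>i. AE \<omega> in \<Omega>. real_cond_exp \<Omega> N (indicator {\<omega> \<in> space \<Omega>. a \<omega> = i}) \<omega> = p i"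
  shows "integrable \<Omega> (\<lambda>\<omega>. h (X \<omega>) (a \<omega>))"
    and "AE \<omega> in \<Omega>. real_cond_exp \<Omega> N (\<lambda>\<omega>. h (X \<omega>) (a \<omega>)) \<omega> = (\<Sum>i\<in>UNIV. p i * h (X \<omega>) i)"
proof -
  interpret prob_space \<Omega> by fact
  interpret sigma_finite_subalgebra \<Omega> N
    by (rule finite_measure_subalgebra_is_sigma_finite)
      (simp add: finite_measure_subalgebra_def finite_measure_subalgebra_axioms_def sub
        finite_measure_axioms)
  \<comment> \<open>A simple function is bounded, hence integrable on a probability space.\<close>
  have integrable: "integrable \<Omega> u" if "simple_function \<Omega> u" for u :: "'w \<Rightarrow> real"
  proof -
    from that have "bounded (u ` space \<Omega>)"
      by (simp add: finite_imp_bounded simple_functionD)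
    then obtain C where "\<And>\<omega>. \<omega> \<in> space \<Omega> \<Longrightarrow> norm (u \<omega>) \<le> C"
      by (auto simp: bounded_iff)
    with that show ?thesis
      by (intro integrable_const_bound[of _ C]) (auto intro: borel_measurable_simple_function)
  qed
  let ?I = "\<lambda>i. indicator {\<omega> \<in> space \<Omega>. a \<omega> = i} :: 'w \<Rightarrow> real"
  have A: "{\<omega> \<in> space \<Omega>. a \<omega> = i} \<in> sets \<Omega>" for i
    using measurable_sets[OF a, of "{i}"] by (simp add: vimage_def Int_def conj_commute)
  have X': "simple_function \<Omega> X"
    using X sub unfolding simple_function_def subalgebra_def by (metis subsetD)
  have a': "simple_function \<Omega> a"
    using a by (simp add: simple_function_eq_measurable)
  show int: "integrable \<Omega> (\<lambda>\<omega>. h (X \<omega>) (a \<omega>))"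
    by (intro integrable simple_function_compose2[OF X' a'])
  have h: "(\<lambda>\<omega>. h (X \<omega>) i) \<in> borel_measurable N" for i
    by (intro borel_measurable_simple_function simple_function_compose1[OF X])
  have int_i: "integrable \<Omega> (\<lambda>\<omega>. h (X \<omega>) i * ?I i \<omega>)" for i
    by (intro integrable simple_function_mult simple_function_compose1[OF X']
        simple_function_indicator A)
  \<comment> \<open>Exactly one indicator is one. The coefficients \<open>h (X \<omega>) i\<close>
    are measurable for \<open>N\<close> and can be pulled out of the conditional
    expectation.\<close>
  have "h (X \<omega>) (a \<omega>) = (\<Sum>i\<in>UNIV. h (X \<omega>) i * ?I i \<omega>)" if "\<omega> \<in> space \<Omega>" for \<omega>
    using that by (simp add: indicator_def if_distrib cong: if_cong)
  then have "AE \<omega> in \<Omega>. real_cond_exp \<Omega> N (\<lambda>\<omega>. h (X \<omega>) (a \<omega>)) \<omega>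
      = real_cond_exp \<Omega> N (\<lambda>\<omega>. \<Sum>i\<in>UNIV. h (X \<omega>) i * ?I i \<omega>) \<omega>"
    using int int_i by (intro real_cond_exp_cong borel_measurable_sum) auto
  moreover have "AE \<omega> in \<Omega>. real_cond_exp \<Omega> N (\<lambda>\<omega>. \<Sum>i\<in>UNIV. h (X \<omega>) i * ?I i \<omega>) \<omega>
      = (\<Sum>i\<in>UNIV. real_cond_exp \<Omega> N (\<lambda>\<omega>. h (X \<omega>) i * ?I i \<omega>) \<omega>)"
    by (intro real_cond_exp_sum int_i)
  moreover have "AE \<omega> in \<Omega>. \<forall>i\<in>UNIV. real_cond_exp \<Omega> N (\<lambda>\<omega>. h (X \<omega>) i * ?I i \<omega>) \<omega>
      = h (X \<omega>) i * real_cond_exp \<Omega> N (?I i) \<omega>"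
    using h int_i A by (intro AE_finite_allI real_cond_exp_mult) auto
  moreover have "AE \<omega> in \<Omega>. \<forall>i\<in>UNIV. real_cond_exp \<Omega> N (?I i) \<omega> = p i"
    using p by (intro AE_finite_allI) auto
  ultimately show "AE \<omega> in \<Omega>. real_cond_exp \<Omega> N (\<lambda>\<omega>. h (X \<omega>) (a \<omega>)) \<omega>
      = (\<Sum>i\<in>UNIV. p i * h (X \<omega>) i)"
    by eventually_elim (simp add: mult.commute)
qed

text \<open>Geometric decay makes the expectations summable. Interchanging sum and integral, the
  series of the \<open>V t \<omega>\<close> is finite almost everywhere, so its terms tend to
  zero.\<close>

lemma AE_tendsto_zero_of_geometric_expectation:
  fixes V :: "nat \<Rightarrow> 'w \<Rightarrow> real"
  assumes int: "\<And>t. integrable \<Omega> (V t)" and nonneg: "\<And>t \<omega>. 0 \<le> V t \<omega>"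
    and q: "0 \<le> q" "q < 1"
    and dec: "\<And>t. (\<integral>\<omega>. V (Suc t) \<omega> \<partial>\<Omega>) \<le> q * (\<integral>\<omega>. V t \<omega> \<partial>\<Omega>)"
  shows "AE \<omega> in \<Omega>. (\<lambda>t. V t \<omega>) \<longlonglongrightarrow> 0"
proof -
  let ?E = "\<lambda>t. \<integral>\<omega>. V t \<omega> \<partial>\<Omega>"
  have E: "0 \<le> ?E t \<and> ?E t \<le> ?E 0 * q ^ t" for t
  proof (induction t)
    case (Suc t)
    from Suc q have "q * ?E t \<le> q * (?E 0 * q ^ t)" by (intro mult_left_mono) auto
    with dec[of t] show ?case by (simp add: nonneg mult_ac)
  qed (simp add: nonneg)
  have "summable ?E"
    by (rule summable_comparison_test'[where g = "\<lambda>t. ?E 0 * q ^ t" and N = 0])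
      (use E q in \<open>auto intro!: summable_mult summable_geometric\<close>)
  then have "(\<Sum>t. ennreal (?E t)) \<noteq> top"
    using E by (intro ennreal_suminf_neq_top) auto
  moreover have "(\<integral>\<^sup>+\<omega>. (\<Sum>t. ennreal (V t \<omega>)) \<partial>\<Omega>) = (\<Sum>t. ennreal (?E t))"
    using int nonneg by (subst nn_integral_suminf) (auto simp: nn_integral_eq_integral)
  ultimately have "AE \<omega> in \<Omega>. (\<Sum>t. ennreal (V t \<omega>)) \<noteq> \<infinity>"
    using int by (intro nn_integral_PInf_AE) auto
  then show ?thesis
    by eventually_elim (auto intro!: summable_LIMSEQ_zero summable_suminf_not_top nonneg)
qed

section \<open>The activation filtration and measurability of the iterates\<close>

lemma act_vimage_sets:
  assumes "s \<in> {1..t}"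
  shows "act s -` A \<inter> space \<Omega> \<in> sets (act_filtration \<Omega> act t)"
  using assms unfolding act_filtration_def
  by (subst sets_measure_of) (auto intro!: sigma_sets.Basic)

lemma space_act_filtration: "space (act_filtration \<Omega> act t) = space \<Omega>"
  unfolding act_filtration_def by (rule space_measure_of) auto

lemma subalgebra_act_filtration:
  assumes "\<And>s. s \<ge> 1 \<Longrightarrow> act s \<in> measurable \<Omega> (count_space UNIV)"
  shows "subalgebra \<Omega> (act_filtration \<Omega> act t)"
proof -
  let ?G = "\<Union>s\<in>{1..t}. range (\<lambda>A. act s -` A \<inter> space \<Omega>)"
  have "?G \<subseteq> sets \<Omega>" using assms measurable_sets by fastforce
  then have "sigma_sets (space \<Omega>) ?G \<subseteq> sets \<Omega>" by (rule sets.sigma_sets_subset)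
  moreover have "sets (act_filtration \<Omega> act t) = sigma_sets (space \<Omega>) ?G"
    unfolding act_filtration_def by (rule sets_measure_of) auto
  ultimately show ?thesis by (simp add: subalgebra_def space_act_filtration)
qed

lemma simple_function_act:
  fixes act :: "nat \<Rightarrow> 'w \<Rightarrow> 'n :: finite"
  assumes "s \<in> {1..t}"
  shows "simple_function (act_filtration \<Omega> act t) (act s)"
  using act_vimage_sets[OF assms, of act _ \<Omega>] by (simp add: simple_function_def space_act_filtration)

text \<open>Finitely many activations produce finitely many values, and simple functions stay simple
  under arbitrary maps such as \<open>step p \<epsilon>\<close>. Allowing \<open>t \<le> u\<close>
  keeps the sigma-field fixed during the induction.\<close>

lemma (in penalized_consensus) simple_function_ann_iterate:
  assumes "\<And>i. p $ i \<noteq> 0" "t \<le> u"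
  shows "simple_function (act_filtration \<Omega> act u) (ann_iterate W \<alpha> f p \<epsilon> act t)"
  using assms(2)
proof (induction t)
  case 0
  have "ann_iterate W \<alpha> f p \<epsilon> act 0 = (\<lambda>_. 0)" by (intro ext) simp
  then show ?case by (simp only: simple_function_const)
next
  case (Suc t)
  have "simple_function (act_filtration \<Omega> act u)
      (\<lambda>\<omega>. step p \<epsilon> (ann_iterate W \<alpha> f p \<epsilon> act t \<omega>) (act (Suc t) \<omega>))"
    by (rule simple_function_compose2[OF Suc.IH simple_function_act]) (use Suc.prems in auto)
  moreover have "ann_iterate W \<alpha> f p \<epsilon> act (Suc t)
      = (\<lambda>\<omega>. step p \<epsilon> (ann_iterate W \<alpha> f p \<epsilon> act t \<omega>) (act (Suc t) \<omega>))"
    by (intro ext ann_iterate_Suc assms)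
  ultimately show ?case by (simp only:)
qed

section \<open>Descent inequality and almost sure convergence\<close>

theorem mainTheorem1:
  fixes W :: "real ^ 'n ^ 'n"
    and E :: "('n \<times> 'n) set"
    and f :: "'n \<Rightarrow> real \<Rightarrow> real"
    and p :: "real ^ 'n"
    and \<alpha> \<epsilon> m M L \<delta> \<Delta> p_min p_max lam Lam :: real
    and \<Omega> :: "'w measure"
    and act :: "nat \<Rightarrow> 'w \<Rightarrow> 'n"
    and F :: "real ^ 'n \<Rightarrow> real"
    and x :: "nat \<Rightarrow> 'w \<Rightarrow> real ^ 'n"
  assumes graph: "sym E"
    and alpha: "\<alpha> > 0"
    and W_symmetric: "transpose W = W"
    and W_ones: "W *v 1 = 1"
    and W_null: "{v. (mat 1 - W) *v v = 0} = span {1}"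
    and W_entries: "\<And>i j. 0 \<le> W $ i $ j \<and> W $ i $ j < 1"
    and W_graph: "\<And>i j. i \<noteq> j \<Longrightarrow> W $ i $ j \<noteq> 0 \<longleftrightarrow> (i, j) \<in> E"
    and f_convex: "\<And>i. convex_on UNIV (f i)"
    and f_diff: "\<And>i s. f i field_differentiable at s"
    and f_diff2: "\<And>i s. deriv (f i) field_differentiable at s"
    and f_C2: "\<And>i. continuous_on UNIV (deriv (deriv (f i)))"
    and m_pos: "0 < m"
    and f_bounds: "\<And>i s. m \<le> deriv (deriv (f i)) s \<and> deriv (deriv (f i)) s \<le> M"
    and f_Lipschitz:
      "\<And>i s s'. \<bar>deriv (deriv (f i)) s - deriv (deriv (f i)) s'\<bar> \<le> L * \<bar>s - s'\<bar>"
    and delta: "0 < \<delta>" "\<delta> \<le> \<Delta>" "\<Delta> < 1"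
    and W_diag: "\<And>i. \<delta> \<le> W $ i $ i \<and> W $ i $ i \<le> \<Delta>"
    and p_sum: "(\<Sum>i\<in>UNIV. p $ i) = 1"
    and p_bounds: "0 < p_min" "\<And>i. p_min \<le> p $ i \<and> p $ i \<le> p_max" "p_max < 1"
    and prob: "prob_space \<Omega>"
    and act_random: "\<And>t. t \<ge> 1 \<Longrightarrow> act t \<in> measurable \<Omega> (count_space UNIV)"
    and act_cond: "\<And>t i. t \<ge> 1 \<Longrightarrow>
      AE \<omega> in \<Omega>. real_cond_exp \<Omega> (act_filtration \<Omega> act (t - 1))
                    (indicator {\<omega> \<in> space \<Omega>. act t \<omega> = i}) \<omega> = p $ i"
    and F_eq: "F = objective W \<alpha> f"
    and x_eq: "x = ann_iterate W \<alpha> f p \<epsilon> act"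
    and lam_eq: "lam = lambda_const \<alpha> \<delta> M"
    and Lam_eq: "Lam = Lambda_const \<alpha> \<delta> \<Delta> m"
    and step: "0 < \<epsilon>" "\<epsilon> \<le> 2 * p_min * (lam / Lam)\<^sup>2"
  shows "(\<forall>t\<ge>1. AE \<omega> in \<Omega>.
            real_cond_exp \<Omega> (act_filtration \<Omega> act (t - 1)) (\<lambda>\<omega>. F (x t \<omega>)) \<omega>
              \<le> F (x (t - 1) \<omega>)
                 - (\<epsilon> * lam - \<epsilon>\<^sup>2 * Lam\<^sup>2 / (2 * lam * p_min))
                     * (norm (gradient F (x (t - 1) \<omega>)))\<^sup>2)
       \<and> (AE \<omega> in \<Omega>. (\<lambda>t. F (x t \<omega>)) \<longlonglongrightarrow> F (arg_min F (\<lambda>_. True)))"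
proof -
  interpret penalized_consensus W \<alpha> m M \<delta> \<Delta> f
    by unfold_locales (fact alpha W_symmetric W_ones W_entries[THEN conjunct1] f_diff f_diff2
      m_pos f_bounds delta W_diag)+
  interpret prob_space \<Omega> by fact
  have p_pos: "0 < p $ i" for i using p_bounds less_le_trans by blast
  then have p_ne: "p $ i \<noteq> 0" for i by (metis less_irrefl)
  have x_Suc: "x (Suc t) \<omega> = step p \<epsilon> (x t \<omega>) (act (Suc t) \<omega>)" for t \<omega>
    unfolding x_eq by (rule ann_iterate_Suc[OF p_ne])
  have simple: "simple_function (act_filtration \<Omega> act t) (x t)" for t
    unfolding x_eq by (intro simple_function_ann_iterate p_ne order_refl)
  \<comment> \<open>Instantiating \<open>act_cond\<close> at a successor turns the index
    \<open>t - 1\<close> into \<open>t\<close>.\<close>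
  note kernel = real_cond_exp_finite_kernel[OF prob subalgebra_act_filtration[OF act_random]
      simple act_random act_cond[of "Suc _", simplified]]
  have int_Suc: "integrable \<Omega> (\<lambda>\<omega>. F (x (Suc t) \<omega>))" for t
    unfolding x_Suc by (rule kernel(1)[where h = "\<lambda>x i. F (step p \<epsilon> x i)"]) simp_all
  \<comment> \<open>The initial point is not produced by an activation, but there \<open>F\<close>
    is constant.\<close>
  have int: "integrable \<Omega> (\<lambda>\<omega>. F (x t \<omega>))" for t
  proof (cases t)
    case 0
    then show ?thesis by (simp add: x_eq)
  qed (simp only: int_Suc)
  have lam: "0 < lam" and Lam: "0 < Lam" and Klam: "K * lam < 1"
    unfolding lam_eq Lam_eq by (rule lam_pos Lam_pos K_lam_less_1)+
  define c where "c = \<epsilon> * lam - \<epsilon>\<^sup>2 * Lam\<^sup>2 * K / (2 * p_min)"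
  have descent: "AE \<omega> in \<Omega>. real_cond_exp \<Omega> (act_filtration \<Omega> act t) (\<lambda>\<omega>. F (x (Suc t) \<omega>)) \<omega>
      \<le> F (x t \<omega>) - c * (norm (gradient F (x t \<omega>)))\<^sup>2" for t
  proof -
    have "AE \<omega> in \<Omega>. real_cond_exp \<Omega> (act_filtration \<Omega> act t) (\<lambda>\<omega>. F (x (Suc t) \<omega>)) \<omega>
        = (\<Sum>i\<in>UNIV. p $ i * F (step p \<epsilon> (x t \<omega>) i))"
      unfolding x_Suc by (rule kernel(2)[where h = "\<lambda>x i. F (step p \<epsilon> x i)"]) simp_all
    then show ?thesis
      using expected_step_le[OF _ p_bounds(1) _ p_sum, of \<epsilon>] p_bounds(2) step(1)
      by (auto simp: c_def F_eq lam_eq Lam_eq)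
  qed
  \<comment> \<open>Replacing \<open>K\<close> by the larger \<open>1 / lam\<close> turns the
    sharper decrease into the stated one.\<close>
  have c_ge: "\<epsilon> * lam - \<epsilon>\<^sup>2 * Lam\<^sup>2 / (2 * lam * p_min) \<le> c"
  proof -
    have "\<epsilon>\<^sup>2 * Lam\<^sup>2 / (2 * p_min) * K \<le> \<epsilon>\<^sup>2 * Lam\<^sup>2 / (2 * p_min) * (1 / lam)"
      using Klam lam p_bounds(1) by (intro mult_left_mono) (auto simp: field_simps)
    then show ?thesis by (simp add: c_def mult_ac)
  qed
  have first: "AE \<omega> in \<Omega>. real_cond_exp \<Omega> (act_filtration \<Omega> act (t - 1)) (\<lambda>\<omega>. F (x t \<omega>)) \<omega>
      \<le> F (x (t - 1) \<omega>) - (\<epsilon> * lam - \<epsilon>\<^sup>2 * Lam\<^sup>2 / (2 * lam * p_min))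
          * (norm (gradient F (x (t - 1) \<omega>)))\<^sup>2" if "t \<ge> 1" for t
  proof -
    from that have t: "Suc (t - 1) = t" by simp
    show ?thesis
      using descent[of "t - 1"] unfolding t
    proof eventually_elim
      case (elim \<omega>)
      then show ?case
        using mult_right_mono[OF c_ge, of "(norm (gradient F (x (t - 1) \<omega>)))\<^sup>2"] by simp
    qed
  qed
  have c_pos: "0 < c"
  proof -
    \<comment> \<open>This is the stepsize bound rearranged; multiplied by
      \<open>\<epsilon> K\<close> it bounds the quadratic loss by
      \<open>\<epsilon> lam (K lam)\<close>, strictly less than
      \<open>\<epsilon> lam\<close>.\<close>
    have "\<epsilon> * Lam\<^sup>2 / (2 * p_min) \<le> lam\<^sup>2"
      using step(2) Lam p_bounds(1) by (simp add: field_simps power_divide)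
    then have "\<epsilon> * K * (\<epsilon> * Lam\<^sup>2 / (2 * p_min)) \<le> \<epsilon> * K * lam\<^sup>2"
      using step(1) K_pos by (intro mult_left_mono) auto
    also have "\<dots> = \<epsilon> * lam * (K * lam)" by (simp add: power2_eq_square)
    also have "\<dots> < \<epsilon> * lam * 1"
      using step(1) lam Klam by (intro mult_strict_left_mono) auto
    finally show ?thesis by (simp add: c_def power2_eq_square mult_ac)
  qed
  define Fs where "Fs = F (arg_min F (\<lambda>_. True))"
  define V where "V = (\<lambda>t \<omega>. F (x t \<omega>) - Fs)"
  \<comment> \<open>The factor from combining descent with \<open>F_gap_le\<close>. The maximum with
    zero secures \<open>0 \<le> q\<close> and is harmless because \<open>V\<close> is
    nonnegative.\<close>
  define q where "q = max 0 (1 - 2 * (\<alpha> * m) * c)"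
  have V_nonneg: "0 \<le> V t \<omega>" for t \<omega>
    unfolding V_def Fs_def F_eq using F_arg_min_le by simp
  have mu: "0 < \<alpha> * m" using alpha m_pos by simp
  have int_V: "integrable \<Omega> (V t)" for t
    unfolding V_def using int by auto
  have V_dec: "(\<integral>\<omega>. V (Suc t) \<omega> \<partial>\<Omega>) \<le> q * (\<integral>\<omega>. V t \<omega> \<partial>\<Omega>)" for t
  proof -
    interpret sub: sigma_finite_subalgebra \<Omega> "act_filtration \<Omega> act t"
      by (rule finite_measure_subalgebra_is_sigma_finite)
        (simp add: finite_measure_subalgebra_def finite_measure_subalgebra_axioms_def
          subalgebra_act_filtration[OF act_random] finite_measure_axioms)
    have "AE \<omega> in \<Omega>. real_cond_exp \<Omega> (act_filtration \<Omega> act t) (\<lambda>\<omega>. F (x (Suc t) \<omega>)) \<omega>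
        \<le> q * V t \<omega> + Fs"
      using descent[of t]
    proof eventually_elim
      case (elim \<omega>)
      have "V t \<omega> \<le> (norm (gradient F (x t \<omega>)))\<^sup>2 / (2 * (\<alpha> * m))"
        unfolding V_def Fs_def F_eq by (rule F_gap_le)
      with mu have "2 * (\<alpha> * m) * V t \<omega> \<le> (norm (gradient F (x t \<omega>)))\<^sup>2"
        using pos_le_divide_eq[of "2 * (\<alpha> * m)" "V t \<omega>"] by (simp add: mult.commute)
      then have "c * (2 * (\<alpha> * m) * V t \<omega>) \<le> c * (norm (gradient F (x t \<omega>)))\<^sup>2"
        using c_pos by (intro mult_left_mono) auto
      moreover have "(1 - 2 * (\<alpha> * m) * c) * V t \<omega> \<le> q * V t \<omega>"
        unfolding q_def by (intro mult_right_mono V_nonneg) auto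
      ultimately show ?case using elim by (simp add: V_def algebra_simps)
    qed
    \<comment> \<open>Integrating removes the conditioning, since a conditional expectation has the
      same integral as the function itself.\<close>
    then have "(\<integral>\<omega>. real_cond_exp \<Omega> (act_filtration \<Omega> act t) (\<lambda>\<omega>. F (x (Suc t) \<omega>)) \<omega> \<partial>\<Omega>)
        \<le> (\<integral>\<omega>. q * V t \<omega> + Fs \<partial>\<Omega>)"
      using int_V by (intro integral_mono_AE sub.real_cond_exp_int int) auto
    then show ?thesis
      using int_V[of t] int[of "Suc t"]
      by (simp add: sub.real_cond_exp_int(2)[OF int] prob_space V_def)
  qed
  have "AE \<omega> in \<Omega>. (\<lambda>t. V t \<omega>) \<longlonglongrightarrow> 0"
  proof (rule AE_tendsto_zero_of_geometric_expectation)
    show "0 \<le> q" "q < 1"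
      using mu c_pos by (auto simp: q_def)
  qed (fact int_V V_nonneg V_dec)+
  then have "AE \<omega> in \<Omega>. (\<lambda>t. F (x t \<omega>)) \<longlonglongrightarrow> Fs"
    by eventually_elim (simp add: V_def LIM_zero_iff)
  with first show ?thesis by (simp add: Fs_def)
qed

end
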